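(* Let $\mathbb{K}$ be $\mathbb{R}$ or $\mathbb{C}$, let $\hbar\in\mathbb{K}$ be nonzero, let $\alpha\in\mathbb{K}$, and let $A_\hbar$, $L_{(2)}\in M_3(A_\hbar)$ and $\lambda_{20},\lambda_{11},\lambda_{02}$ be as defined in the context. Assume that $\lambda_{20},\lambda_{11},\lambda_{02}$ lie in $\mathbb{K}$ (take $\mathbb{K}=\mathbb{C}$ if they are not real) and are pairwise distinct. Then the quantum line bundle $E^{1,1}(\hbar)$, i.e. the projective right $A_\hbar$-module corresponding to the idempotent $$e_{11}=\frac{(\lambda_{20}\,\mathrm{id}-L_{(2)})(\lambda_{02}\,\mathrm{id}-L_{(2)})}{(\lambda_{20}-\lambda_{11})(\lambda_{02}-\lambda_{11})}\in M_3(A_\hbar),$$ is isomorphic (in the sense of the definition in the context) to the trivial quantum line bundle $E^{0,0}(\hbar)$, i.e. the module $A_\hbar$ itself, corresponding to the idempotent $e_{00}=1\in M_1(A_\hbar)$.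
   Context: The Lie algebra $gl(2)_\hbar$ over $\mathbb{K}$ is generated by $a,b,c,d$ with brackets $$[a,b]=\hbar b,\quad [a,c]=-\hbar c,\quad [a,d]=0,\quad [b,c]=\hbar(a-d),\quad [b,d]=\hbar b,\quad [c,d]=-\hbar c .$$ In its enveloping algebra the elements $\mathrm{tr}=a+d$ and $\triangle=ad-(bc+cb)/2$ are central. Define $$A_\hbar=U(gl(2)_\hbar)/\{\mathrm{tr},\ \triangle-\alpha\},$$ where $\{X\}$ denotes the two-sided ideal generated by $X$ (so $d=-a$ and $\triangle=\alpha$ in $A_\hbar$). Let $L_{(2)}$ be the $3\times 3$ matrix $$L_{(2)}=\begin{pmatrix}2a&2b&0\\ c&0&b\\ 0&2c&-2a\end{pmatrix}\in M_3(A_\hbar).$$ (It is the extension of $L=\begin{pmatrix} a&b\\ c&d\end{pmatrix}$ to the symmetric square of a 2-dimensional space $V$: the restriction of $\frac12(\mathrm{id}+P)(L\otimes\mathrm{id})(\mathrm{id}+P)$ to $\mathrm{Sym}^2(V)$, with $P$ the flip, in the basis $v_1^{\otimes 2},\ v_1\otimes v_2+v_2\otimes v_1,\ v_2^{\otimes 2}$.) It satisfies the identity $L_{(2)}^3-4\hbar L_{(2)}^2+4(\alpha+\hbar^2)L_{(2)}-8\hbar\alpha\,\mathrm{id}=0$, whose roots ("eigenvalues" of $L_{(2)}$) are $$\lambda_{20}=\hbar-\sqrt{\hbar^2-4\alpha},\qquad \lambda_{11}=2\hbar,\qquad \lambda_{02}=\hbar+\sqrt{\hbar^2-4\alpha}.$$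 When these are pairwise distinct, $e_{11}$ is an idempotent. An idempotent $e\in M_n(A)$ over an algebra $A$ corresponds to the projective right $A$-module $eA^{\oplus n}\subset A^{\oplus n}$. Definition (isomorphic modules): two projective modules $M_1\subset A^{\oplus m}$ and $M_2\subset A^{\oplus n}$ over an algebra $A$, corresponding to idempotents $e_1\in M_m(A)$ and $e_2\in M_n(A)$ respectively, are isomorphic iff there exist matrices $X\in M_{m,n}(A)$ and $Y\in M_{n,m}(A)$ such that $$XY=e_1,\quad YX=e_2,\quad X=e_1X=Xe_2,\quad Y=e_2Y=Ye_1 .$$ *)

theory Defs
  imports
    "HOL-Library.Poly_Mapping"
    "HOL-Algebra.Algebraic_Closure_Type"
    "HOL-Algebra.QuotRing"
    "Jordan_Normal_Form.Matrix"
begin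

section \<open>Free associative algebras\<close>

text \<open>
  The free monoid is wrapped in a datatype and written additively because the convolution
  product of \<^typ>\<open>'a \<Rightarrow>\<^sub>0 'b\<close> is defined for an index type of class \<^class>\<open>monoid_add\<close>.
  The type \<open>'g free_monoid \<Rightarrow>\<^sub>0 'k\<close> is then the free associative unital algebra (the tensor
  algebra of the space with basis \<open>'g\<close>).
\<close>

datatype 'g free_monoid = FM "'g list"

instantiation free_monoid :: (type) monoid_add
begin

definition zero_free_monoid :: "'a free_monoid"
  where "0 = FM []"

fun plus_free_monoid :: "'a free_monoid \<Rightarrow> 'a free_monoid \<Rightarrow> 'a free_monoid"
  where "FM u + FM v = FM (u @ v)"

instance
proof
  fix x y z :: "'a free_monoid"
  show "x + y + z = x + (y + z)" by (cases x; cases y; cases z) simp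
  show "0 + x = x" by (cases x) (simp add: zero_free_monoid_def)
  show "x + 0 = x" by (cases x) (simp add: zero_free_monoid_def)
qed

end

type_synonym ('g, 'k) free_alg = "'g free_monoid \<Rightarrow>\<^sub>0 'k"

abbreviation free_algebra :: "('g, 'k::field) free_alg ring"
  where "free_algebra \<equiv> ring_of_type_algebra"

definition gen :: "'g \<Rightarrow> ('g, 'k::field) free_alg"
  where "gen x = Poly_Mapping.single (FM [x]) 1"

definition const :: "'k::field \<Rightarrow> ('g, 'k) free_alg"
  where "const r = Poly_Mapping.single 0 r"


section \<open>Enveloping algebras\<close>

text \<open>
  A finite-dimensional Lie algebra with basis \<open>'g\<close> is given by its structure constants:
  \<open>[u, v] = (\<Sum>w. sc u v w \<cdot> w)\<close> for basis elements \<open>u\<close>, \<open>v\<close>. Its elements are the coordinate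
  functions \<open>'g \<Rightarrow> 'k\<close>.
\<close>

definition lie_bracket ::
    "('g::finite \<Rightarrow> 'g \<Rightarrow> 'g \<Rightarrow> 'k::field) \<Rightarrow> ('g \<Rightarrow> 'k) \<Rightarrow> ('g \<Rightarrow> 'k) \<Rightarrow> ('g \<Rightarrow> 'k)"
  where "lie_bracket sc x y = (\<lambda>w. \<Sum>u\<in>UNIV. \<Sum>v\<in>UNIV. x u * y v * sc u v w)"

definition lie_embed :: "('g::finite \<Rightarrow> 'k::field) \<Rightarrow> ('g, 'k) free_alg"
  where "lie_embed x = (\<Sum>u\<in>UNIV. const (x u) * gen u)"

definition env_ideal ::
    "('g::finite \<Rightarrow> 'g \<Rightarrow> 'g \<Rightarrow> 'k::field) \<Rightarrow> ('g, 'k) free_alg set"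
  where "env_ideal sc = Idl\<^bsub>free_algebra\<^esub>
    {lie_embed x * lie_embed y - lie_embed y * lie_embed x - lie_embed (lie_bracket sc x y)
      | x y. True}"

definition env_algebra ::
    "('g::finite \<Rightarrow> 'g \<Rightarrow> 'g \<Rightarrow> 'k::field) \<Rightarrow> ('g, 'k) free_alg set ring"
  where "env_algebra sc = free_algebra Quot env_ideal sc"

definition env_class ::
    "('g::finite \<Rightarrow> 'g \<Rightarrow> 'g \<Rightarrow> 'k::field) \<Rightarrow> ('g, 'k) free_alg \<Rightarrow> ('g, 'k) free_alg set"
  where "env_class sc p = env_ideal sc +>\<^bsub>free_algebra\<^esub> p"


section \<open>The algebra \<open>A\<^sub>\<hbar>\<close>\<close>

datatype gl2 = Ga | Gb | Gc | Gd

instance gl2 :: finite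
proof
  have "UNIV = {Ga, Gb, Gc, Gd}" by (auto intro: gl2.exhaust)
  then show "finite (UNIV :: gl2 set)" by (metis finite.emptyI finite.insertI)
qed

fun gl2_upper :: "'k::field \<Rightarrow> gl2 \<Rightarrow> gl2 \<Rightarrow> gl2 \<Rightarrow> 'k" where
  "gl2_upper h Ga Gb = (\<lambda>_. 0)(Gb := h)"
| "gl2_upper h Ga Gc = (\<lambda>_. 0)(Gc := - h)"
| "gl2_upper h Ga Gd = (\<lambda>_. 0)"
| "gl2_upper h Gb Gc = (\<lambda>_. 0)(Ga := h, Gd := - h)"
| "gl2_upper h Gb Gd = (\<lambda>_. 0)(Gb := h)"
| "gl2_upper h Gc Gd = (\<lambda>_. 0)(Gc := - h)"
| "gl2_upper h _ _ = (\<lambda>_. 0)"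

text \<open>The structure constants of \<open>gl(2)\<^sub>\<hbar>\<close>: the antisymmetric extension of the table above.\<close>

definition gl2_sc :: "'k::field \<Rightarrow> gl2 \<Rightarrow> gl2 \<Rightarrow> gl2 \<Rightarrow> 'k"
  where "gl2_sc h u v w = gl2_upper h u v w - gl2_upper h v u w"

definition tr_elt :: "(gl2, 'k::field) free_alg"
  where "tr_elt = gen Ga + gen Gd"

definition delta_elt :: "(gl2, 'k::field) free_alg"
  where "delta_elt = gen Ga * gen Gd - const (1 / 2) * (gen Gb * gen Gc + gen Gc * gen Gb)"

definition A_ideal :: "'k::field \<Rightarrow> 'k \<Rightarrow> (gl2, 'k) free_alg set set"
  where "A_ideal h \<alpha> = Idl\<^bsub>env_algebra (gl2_sc h)\<^esub>
    {env_class (gl2_sc h) tr_elt, env_class (gl2_sc h) (delta_elt - const \<alpha>)}"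

definition A_alg :: "'k::field \<Rightarrow> 'k \<Rightarrow> (gl2, 'k) free_alg set set ring"
  where "A_alg h \<alpha> = env_algebra (gl2_sc h) Quot A_ideal h \<alpha>"

definition A_class ::
    "'k::field \<Rightarrow> 'k \<Rightarrow> (gl2, 'k) free_alg \<Rightarrow> (gl2, 'k) free_alg set set"
  where "A_class h \<alpha> p = A_ideal h \<alpha> +>\<^bsub>env_algebra (gl2_sc h)\<^esub> env_class (gl2_sc h) p"


section \<open>Matrices over a ring and projective modules\<close>

text \<open>
  The arithmetic of \<^typ>\<open>'a mat\<close> in the library is tied to type classes. Here it is only used as
  a container, with operations taken from a (noncommutative) ring with carrier.
\<close>

definition rmats :: "('a, 'b) ring_scheme \<Rightarrow> nat \<Rightarrow> nat \<Rightarrow> 'a mat set"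
  where "rmats R m n = {P \<in> carrier_mat m n. \<forall>i<m. \<forall>j<n. P $$ (i, j) \<in> carrier R}"

definition rmat_mult :: "('a, 'b) ring_scheme \<Rightarrow> 'a mat \<Rightarrow> 'a mat \<Rightarrow> 'a mat"
  where "rmat_mult R P Q = mat (dim_row P) (dim_col Q)
    (\<lambda>(i, j). \<Oplus>\<^bsub>R\<^esub>k\<in>{..<dim_col P}. P $$ (i, k) \<otimes>\<^bsub>R\<^esub> Q $$ (k, j))"

definition rmat_minus :: "('a, 'b) ring_scheme \<Rightarrow> 'a mat \<Rightarrow> 'a mat \<Rightarrow> 'a mat"
  where "rmat_minus R P Q = mat (dim_row P) (dim_col P)
    (\<lambda>(i, j). P $$ (i, j) \<ominus>\<^bsub>R\<^esub> Q $$ (i, j))"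

definition rmat_smult :: "('a, 'b) ring_scheme \<Rightarrow> 'a \<Rightarrow> 'a mat \<Rightarrow> 'a mat"
  where "rmat_smult R r P = map_mat (\<lambda>x. r \<otimes>\<^bsub>R\<^esub> x) P"

definition rmat_one :: "('a, 'b) ring_scheme \<Rightarrow> nat \<Rightarrow> 'a mat"
  where "rmat_one R n = mat n n (\<lambda>(i, j). if i = j then \<one>\<^bsub>R\<^esub> else \<zero>\<^bsub>R\<^esub>)"

definition idempotent_rmat :: "('a, 'b) ring_scheme \<Rightarrow> nat \<Rightarrow> 'a mat \<Rightarrow> bool"
  where "idempotent_rmat R n e \<longleftrightarrow> e \<in> rmats R n n \<and> rmat_mult R e e = e"

text \<open>
  A projective right \<open>R\<close>-module \<open>e R\<^sup>n \<subseteq> R\<^sup>n\<close> is represented by the size \<open>n\<close> and the idempotent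
  matrix \<open>e\<close>; the following is the isomorphism of \<open>e1 R\<^sup>m\<close> and \<open>e2 R\<^sup>n\<close>.
\<close>

definition isomorphic_projective ::
    "('a, 'b) ring_scheme \<Rightarrow> nat \<Rightarrow> 'a mat \<Rightarrow> nat \<Rightarrow> 'a mat \<Rightarrow> bool"
  where "isomorphic_projective R m e1 n e2 \<longleftrightarrow>
    idempotent_rmat R m e1 \<and> idempotent_rmat R n e2 \<and>
    (\<exists>P\<in>rmats R m n. \<exists>Q\<in>rmats R n m.
      rmat_mult R P Q = e1 \<and> rmat_mult R Q P = e2 \<and>
      P = rmat_mult R e1 P \<and> P = rmat_mult R P e2 \<and>
      Q = rmat_mult R e2 Q \<and> Q = rmat_mult R Q e1)"


section \<open>The matrix \<open>L\<^sub>(\<^sub>2\<^sub>)\<close>, its eigenvalues and the idempotents\<close>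

definition L2 :: "'k::field \<Rightarrow> 'k \<Rightarrow> (gl2, 'k) free_alg set set mat"
  where "L2 h \<alpha> = map_mat (A_class h \<alpha>) (mat_of_rows_list 3
    [[const 2 * gen Ga, const 2 * gen Gb, 0],
     [gen Gc,           0,                gen Gb],
     [0,                const 2 * gen Gc, - (const 2 * gen Ga)]])"

text \<open>The parameter \<open>s\<close> stands for a square root of \<open>\<hbar>\<^sup>2 - 4\<alpha>\<close> in the ground field.\<close>

definition lambda20 :: "'k::field \<Rightarrow> 'k \<Rightarrow> 'k"
  where "lambda20 h s = h - s"

definition lambda11 :: "'k::field \<Rightarrow> 'k"
  where "lambda11 h = 2 * h"

definition lambda02 :: "'k::field \<Rightarrow> 'k \<Rightarrow> 'k"
  where "lambda02 h s = h + s"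

text \<open>\<open>scalar_minus_L2 h \<alpha> t\<close> is \<open>t \<cdot> id - L\<^sub>(\<^sub>2\<^sub>)\<close>.\<close>

definition scalar_minus_L2 :: "'k::field \<Rightarrow> 'k \<Rightarrow> 'k \<Rightarrow> (gl2, 'k) free_alg set set mat"
  where "scalar_minus_L2 h \<alpha> t = rmat_minus (A_alg h \<alpha>)
    (rmat_smult (A_alg h \<alpha>) (A_class h \<alpha> (const t)) (rmat_one (A_alg h \<alpha>) 3)) (L2 h \<alpha>)"

definition e11 :: "'k::field \<Rightarrow> 'k \<Rightarrow> 'k \<Rightarrow> (gl2, 'k) free_alg set set mat"
  where "e11 h \<alpha> s = rmat_smult (A_alg h \<alpha>)
    (A_class h \<alpha> (const (1 / ((lambda20 h s - lambda11 h) * (lambda02 h s - lambda11 h)))))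
    (rmat_mult (A_alg h \<alpha>)
      (scalar_minus_L2 h \<alpha> (lambda20 h s)) (scalar_minus_L2 h \<alpha> (lambda02 h s)))"

definition e00 :: "'k::field \<Rightarrow> 'k \<Rightarrow> (gl2, 'k) free_alg set set mat"
  where "e00 h \<alpha> = rmat_one (A_alg h \<alpha>) 1"

end

theory Submission
  imports Defs
begin

text \<open>
  In \<open>A\<^sub>\<hbar>\<close> the column \<open>U = (b, -a, -c)\<^sup>T\<close> and the row \<open>W = (c, -2a, -b)\<close> are right and left
  eigenvectors of \<open>L\<^sub>(\<^sub>2\<^sub>)\<close> for the eigenvalue \<open>2\<hbar>\<close>, and \<open>W U = 2a\<^sup>2 + bc + cb = -2\<alpha>\<close>. The denominator
  of \<open>e\<^sub>1\<^sub>1\<close> is \<open>4\<alpha>\<close>, so \<open>\<alpha>\<close> is nonzero, and \<open>V = -W/(2\<alpha>)\<close> satisfies \<open>V U = 1\<close> and \<open>U V = e\<^sub>1\<^sub>1\<close>.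
  Both identities are checked in the free algebra modulo the kernel of the canonical map.
\<close>

section \<open>Matrices under a homomorphism from a type-class ring\<close>

text \<open>Only \<open>ring_1\<close> is required of the type, so that the noncommutative free
  algebra is covered.\<close>

lemma ring_ring_of_type_algebra: "ring (ring_of_type_algebra :: 'r::ring_1 ring)"
proof -
  have "\<exists>y. x + y = 0" for x :: 'r
    using add.right_inverse by blast
  then show ?thesis
    unfolding ring_of_type_algebra_def using add.right_inverse
    by unfold_locales (auto simp: algebra_simps Units_def)
qed

text \<open>The source is a type-class ring, so matrix identities can be computed there with the
  ordinary arithmetic of \<open>mat\<close> and simp normalization, then pushed along
  \<open>\<phi>\<close> into a ring with carrier.\<close>

locale type_ring_hom = ring R for R (structure) +
  fixes \<phi> :: "'r::ring_1 \<Rightarrow> 'a"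
  assumes hom: "\<phi> \<in> Ring.ring_hom ring_of_type_algebra R"
begin

lemma hom_closed [simp]: "\<phi> x \<in> carrier R"
  and hom_mult: "\<phi> (x * y) = \<phi> x \<otimes> \<phi> y"
  and hom_add: "\<phi> (x + y) = \<phi> x \<oplus> \<phi> y"
  and hom_one: "\<phi> 1 = \<one>"
  using ring_hom_memE[OF hom] by (auto simp: ring_of_type_algebra_def)

lemma hom_zero: "\<phi> 0 = \<zero>"
  by (metis add.r_cancel_one' add_0 hom_add hom_closed)

lemma hom_uminus: "\<phi> (- x) = \<ominus> \<phi> x"
  by (metis add.inv_equality add.left_inverse hom_add hom_closed hom_zero)

lemma hom_diff: "\<phi> (x - y) = \<phi> x \<ominus> \<phi> y"
  by (metis add_uminus_conv_diff a_minus_def hom_add hom_uminus)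

lemma hom_sum: "finite I \<Longrightarrow> \<phi> (\<Sum>i\<in>I. f i) = (\<Oplus>i\<in>I. \<phi> (f i))"
  by (induction I rule: finite_induct) (auto simp: hom_zero hom_add)

lemma hom_eqI: "\<phi> (x - y) = \<zero> \<Longrightarrow> \<phi> x = \<phi> y"
  by (metis diff_add_cancel hom_add hom_closed l_zero)

text \<open>As conditional rewrite rules these discharge combinations of relations with coefficients
  on the left, the shape of every certificate below.\<close>

lemma kernel_closed:
  shows "\<phi> x = \<zero> \<Longrightarrow> \<phi> y = \<zero> \<Longrightarrow> \<phi> (x + y) = \<zero>"
    and "\<phi> x = \<zero> \<Longrightarrow> \<phi> y = \<zero> \<Longrightarrow> \<phi> (x - y) = \<zero>"
    and "\<phi> x = \<zero> \<Longrightarrow> \<phi> (- x) = \<zero>"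
    and "\<phi> x = \<zero> \<Longrightarrow> \<phi> (z * x) = \<zero>"
  by (auto simp: hom_add hom_diff hom_uminus hom_mult a_minus_def)

lemma map_mat_mem_rmats: "P \<in> carrier_mat m n \<Longrightarrow> map_mat \<phi> P \<in> rmats R m n"
  by (auto simp: rmats_def)

text \<open>\<open>rmat_mult\<close> sums over the columns of the left factor,
  \<open>scalar_prod\<close> over the length of its second argument; the dimension hypothesis
  identifies the two ranges.\<close>

lemma rmat_mult_map_mat:
  "dim_col P = dim_row Q \<Longrightarrow> rmat_mult R (map_mat \<phi> P) (map_mat \<phi> Q) = map_mat \<phi> (P * Q)"
  by (rule eq_matI)
    (auto simp: rmat_mult_def scalar_prod_def hom_sum hom_mult atLeast0LessThan intro!: finsum_cong')

lemma rmat_smult_map_mat: "rmat_smult R (\<phi> r) (map_mat \<phi> P) = map_mat \<phi> (r \<cdot>\<^sub>m P)"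
  by (rule eq_matI) (auto simp: rmat_smult_def hom_mult)

lemma rmat_minus_map_mat:
  "P \<in> carrier_mat m n \<Longrightarrow> Q \<in> carrier_mat m n \<Longrightarrow>
    rmat_minus R (map_mat \<phi> P) (map_mat \<phi> Q) = map_mat \<phi> (P - Q)"
  by (rule eq_matI) (auto simp: rmat_minus_def hom_diff)

lemma rmat_one_eq_map_mat: "rmat_one R n = map_mat \<phi> (1\<^sub>m n)"
  by (rule eq_matI) (auto simp: rmat_one_def hom_zero hom_one)

text \<open>Once \<open>Q * P\<close> becomes the identity under \<open>\<phi>\<close>,
  associativity gives \<open>P * Q * P = P\<close> and \<open>Q * P * Q = Q\<close> under
  \<open>\<phi>\<close>; hence \<open>P * Q\<close> becomes idempotent and absorbs both
  factors.\<close>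

lemma isomorphic_projective_rmat_oneI:
  assumes P: "P \<in> carrier_mat m n" and Q: "Q \<in> carrier_mat n m"
    and QP: "map_mat \<phi> (Q * P) = rmat_one R n"
  shows "isomorphic_projective R m (map_mat \<phi> (P * Q)) n (rmat_one R n)"
proof -
  note dims = carrier_matD[OF P] carrier_matD[OF Q]
  have QP': "rmat_mult R (map_mat \<phi> Q) (map_mat \<phi> P) = map_mat \<phi> (1\<^sub>m n)"
    using dims QP by (simp add: rmat_mult_map_mat rmat_one_eq_map_mat)
  have PQP: "map_mat \<phi> (P * Q * P) = map_mat \<phi> P"
  proof -
    have "map_mat \<phi> (P * Q * P) = map_mat \<phi> (P * (Q * P))"
      using P Q by (simp add: assoc_mult_mat[of _ m n _ m])
    also have "\<dots> = rmat_mult R (map_mat \<phi> P) (map_mat \<phi> (1\<^sub>m n))"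
      using dims QP by (simp add: rmat_mult_map_mat[symmetric] rmat_one_eq_map_mat[symmetric])
    also have "\<dots> = map_mat \<phi> P"
      using P by (simp add: rmat_mult_map_mat)
    finally show ?thesis .
  qed
  have QPQ: "map_mat \<phi> (Q * (P * Q)) = map_mat \<phi> Q"
  proof -
    have "map_mat \<phi> (Q * (P * Q)) = map_mat \<phi> (Q * P * Q)"
      using P Q by (simp add: assoc_mult_mat[of _ n m _ n])
    also have "\<dots> = rmat_mult R (map_mat \<phi> (1\<^sub>m n)) (map_mat \<phi> Q)"
      using dims QP by (simp add: rmat_mult_map_mat[symmetric] rmat_one_eq_map_mat[symmetric])
    also have "\<dots> = map_mat \<phi> Q"
      using Q by (simp add: rmat_mult_map_mat)
    finally show ?thesis .
  qed
  have "P * Q * (P * Q) = P * Q * P * Q"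
    by (rule assoc_mult_mat[symmetric]) (use P Q in auto)
  then have "map_mat \<phi> (P * Q * (P * Q)) = rmat_mult R (map_mat \<phi> (P * Q * P)) (map_mat \<phi> Q)"
    using dims by (simp only: rmat_mult_map_mat index_mult_mat)
  then have PQPQ: "map_mat \<phi> (P * Q * (P * Q)) = map_mat \<phi> (P * Q)"
    using dims by (simp add: PQP rmat_mult_map_mat)
  show ?thesis
    unfolding isomorphic_projective_def idempotent_rmat_def
    using P Q dims QP PQP QPQ PQPQ
    by (intro conjI bexI[of _ "map_mat \<phi> P"] bexI[of _ "map_mat \<phi> Q"] map_mat_mem_rmats)
      (auto simp: rmat_mult_map_mat rmat_one_eq_map_mat map_mat_mem_rmats)
qed

end


section \<open>The canonical map onto \<open>A\<^sub>\<hbar>\<close>\<close>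

lemma const_add: "const (x + y) = const x + const y"
  and const_uminus: "const (- x) = - const x"
  and const_zero: "const 0 = 0"
  and const_one: "const 1 = 1"
  and const_mult: "const (x * y) = const x * const y"
  by (simp_all add: const_def single_add single_uminus mult_single)

lemma const_diff: "const (x - y) = const x - const y"
  by (simp add: const_def single_diff)

text \<open>Constants are supported at the empty word, the neutral element of the monoid, so they
  commute with each monomial.\<close>

lemma const_commute: "p * const x = const x * p"
proof (induction p rule: Poly_Mapping.update_induct)
  case (update p u y)
  \<comment> \<open>The key \<open>u\<close> is fresh, so setting its coefficient amounts to adding
    a monomial.\<close>
  then have "Poly_Mapping.update u y p = p + Poly_Mapping.single u y"
    by (intro poly_mapping_eqI) (auto simp: lookup_update lookup_add lookup_single in_keys_iff when_def)
  moreover have "Poly_Mapping.single u y * const x = const x * Poly_Mapping.single u y"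
    by (simp add: const_def mult_single mult.commute)
  ultimately show ?case
    using update by (simp add: algebra_simps)
qed simp

lemma const_left_commute: "p * (const x * q) = const x * (p * q)"
  by (metis const_commute mult.assoc)

lemma UNIV_gl2: "(UNIV :: gl2 set) = {Ga, Gb, Gc, Gd}"
  by (auto intro: gl2.exhaust)

section \<open>The two successive quotients\<close>

lemma ideal_env_ideal: "ideal (env_ideal sc) free_algebra"
  unfolding env_ideal_def
  by (intro ring.genideal_ideal ring_ring_of_type_algebra) (simp add: ring_of_type_algebra_def)

lemma ring_env_algebra: "ring (env_algebra sc)"
  unfolding env_algebra_def by (intro ideal.quotient_is_ring ideal_env_ideal)

lemma env_class_hom: "env_class sc \<in> Ring.ring_hom free_algebra (env_algebra sc)"
  unfolding env_algebra_def env_class_def[abs_def]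
  by (rule ideal.rcos_ring_hom[OF ideal_env_ideal])

text \<open>The coset of a member of \<open>I\<close> is \<open>I\<close> itself, which is the zero
  of the quotient.\<close>

lemma rcos_eq_zero: "ideal I R \<Longrightarrow> x \<in> I \<Longrightarrow> I +>\<^bsub>R\<^esub> x = \<zero>\<^bsub>R Quot I\<^esub>"
  by (simp add: FactRing_def ideal.axioms ideal.axioms(1)[THEN additive_subgroup.a_subgroup]
    abelian_subgroup.a_rcos_const abelian_subgroupI3 ideal.axioms(2) ring.is_abelian_group)

lemma env_class_lie_relation:
  "env_class sc (lie_embed x * lie_embed y - lie_embed y * lie_embed x
    - lie_embed (lie_bracket sc x y)) = \<zero>\<^bsub>env_algebra sc\<^esub>"
  unfolding env_algebra_def env_class_def
proof (rule rcos_eq_zero[OF ideal_env_ideal])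
  show "lie_embed x * lie_embed y - lie_embed y * lie_embed x - lie_embed (lie_bracket sc x y)
    \<in> env_ideal sc"
    unfolding env_ideal_def
    by (rule subsetD[OF ring.genideal_self[OF ring_ring_of_type_algebra]])
      (auto simp: ring_of_type_algebra_def)
qed

lemma env_class_closed: "env_class sc p \<in> carrier (env_algebra sc)"
  using ring_hom_memE(1)[OF env_class_hom] by (simp add: ring_of_type_algebra_def)

lemma ideal_A_ideal: "ideal (A_ideal h \<alpha>) (env_algebra (gl2_sc h))"
  unfolding A_ideal_def
  by (intro ring.genideal_ideal ring_env_algebra) (simp add: env_class_closed)

lemma ring_A_alg: "ring (A_alg h \<alpha>)"
  unfolding A_alg_def by (intro ideal.quotient_is_ring ideal_A_ideal)

text \<open>The map is the composite of the two quotient maps.\<close>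

lemma A_class_hom: "A_class h \<alpha> \<in> Ring.ring_hom free_algebra (A_alg h \<alpha>)"
  using ring_hom_trans[OF env_class_hom ideal.rcos_ring_hom[OF ideal_A_ideal]]
  unfolding A_alg_def A_class_def[abs_def] comp_def .

interpretation A: type_ring_hom "A_alg h \<alpha>" "A_class h \<alpha>"
  for h \<alpha> :: "'k::field"
  by (intro type_ring_hom.intro ring_A_alg type_ring_hom_axioms.intro A_class_hom)

lemma A_class_eq_zeroI:
  assumes "env_class (gl2_sc h) p \<in> A_ideal h \<alpha>"
  shows "A_class h \<alpha> p = \<zero>\<^bsub>A_alg h \<alpha>\<^esub>"
  unfolding A_class_def A_alg_def by (rule rcos_eq_zero[OF ideal_A_ideal assms])

section \<open>The relations that hold in the quotient\<close>

lemma A_class_trace: "A_class h \<alpha> tr_elt = \<zero>\<^bsub>A_alg h \<alpha>\<^esub>"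
  and A_class_casimir: "A_class h \<alpha> (delta_elt - const \<alpha>) = \<zero>\<^bsub>A_alg h \<alpha>\<^esub>"
  by (rule A_class_eq_zeroI; unfold A_ideal_def;
      rule subsetD[OF ring.genideal_self[OF ring_env_algebra]]; simp add: env_class_closed)+

text \<open>\<open>env_ideal\<close> is generated by relations for arbitrary coordinate vectors;
  indicator functions specialize them to the generators.\<close>

lemma lie_embed_basis: "lie_embed (\<lambda>w. if w = u then 1 else (0 :: 'k::field)) = gen u"
proof -
  have "const (if w = u then 1 else (0 :: 'k)) * gen w = (if w = u then gen w else 0)" for w
    by (simp add: const_one const_zero)
  then show ?thesis
    by (simp add: lie_embed_def)
qed

lemma lie_bracket_basis:
  "lie_bracket sc (\<lambda>w. if w = u then 1 else 0) (\<lambda>w. if w = v then 1 else 0) = sc u v"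
proof
  fix w
  have "(\<Sum>v'\<in>UNIV. (if u' = u then 1 else 0) * (if v' = v then 1 else 0) * sc u' v' w)
      = (if u' = u then sc u v w else 0)" for u'
    by (cases "u' = u") (simp_all add: if_distrib[of "\<lambda>x. x * _"] cong: if_cong)
  then show "lie_bracket sc (\<lambda>w. if w = u then 1 else 0) (\<lambda>w. if w = v then 1 else 0) w = sc u v w"
    by (simp add: lie_bracket_def)
qed

text \<open>The relation already vanishes in the enveloping algebra, and zero lies in every ideal
  there.\<close>

lemma A_class_bracket:
  "A_class h \<alpha> (gen u * gen v - gen v * gen u - lie_embed (gl2_sc h u v)) = \<zero>\<^bsub>A_alg h \<alpha>\<^esub>"
proof (rule A_class_eq_zeroI)
  have "env_class (gl2_sc h) (gen u * gen v - gen v * gen u - lie_embed (gl2_sc h u v))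
      = \<zero>\<^bsub>env_algebra (gl2_sc h)\<^esub>"
    using env_class_lie_relation[of "gl2_sc h" "\<lambda>w. if w = u then 1 else 0"
        "\<lambda>w. if w = v then 1 else 0"]
    by (simp only: lie_embed_basis lie_bracket_basis)
  then show "env_class (gl2_sc h) (gen u * gen v - gen v * gen u - lie_embed (gl2_sc h u v))
      \<in> A_ideal h \<alpha>"
    using additive_subgroup.zero_closed[OF ideal.axioms(1)[OF ideal_A_ideal]] by metis
qed

text \<open>The generator \<open>d\<close> is eliminated through the trace. The last relation is
  \<open>delta_elt - const \<alpha>\<close> times -2; integer multiples are spelled as sums to suit
  \<open>algebra_simps\<close>.\<close>

lemma A_class_relations:
  fixes h \<alpha> :: "'k::field_char_0"
  defines "a \<equiv> gen Ga" and "b \<equiv> gen Gb" and "c \<equiv> gen Gc"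
  shows "A_class h \<alpha> (a * b - b * a - const h * b) = \<zero>\<^bsub>A_alg h \<alpha>\<^esub>"
    and "A_class h \<alpha> (a * c - c * a + const h * c) = \<zero>\<^bsub>A_alg h \<alpha>\<^esub>"
    and "A_class h \<alpha> (b * c - c * b - (const h * a + const h * a)) = \<zero>\<^bsub>A_alg h \<alpha>\<^esub>"
    and "A_class h \<alpha> (a * a + a * a + b * c + c * b + const \<alpha> + const \<alpha>) = \<zero>\<^bsub>A_alg h \<alpha>\<^esub>"
proof -
  define d :: "(gl2, 'k) free_alg" where "d = gen Gd"
  note sc_simps = lie_embed_def UNIV_gl2 gl2_sc_def const_zero const_uminus
  show "A_class h \<alpha> (a * b - b * a - const h * b) = \<zero>\<^bsub>A_alg h \<alpha>\<^esub>"
    using A_class_bracket[of h \<alpha> Ga Gb] by (simp add: sc_simps a_def b_def)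
  show "A_class h \<alpha> (a * c - c * a + const h * c) = \<zero>\<^bsub>A_alg h \<alpha>\<^esub>"
    using A_class_bracket[of h \<alpha> Ga Gc] by (simp add: sc_simps a_def c_def)
  have tr: "A_class h \<alpha> (a + d) = \<zero>\<^bsub>A_alg h \<alpha>\<^esub>"
    using A_class_trace by (simp add: tr_elt_def a_def d_def)
  have bc: "A_class h \<alpha> (b * c - c * b - (const h * a - const h * d)) = \<zero>\<^bsub>A_alg h \<alpha>\<^esub>"
    using A_class_bracket[of h \<alpha> Gb Gc] by (simp add: sc_simps b_def c_def a_def d_def)
  have "b * c - c * b - (const h * a + const h * a)
      = b * c - c * b - (const h * a - const h * d) - const h * (a + d)"
    by (simp add: algebra_simps)
  then show "A_class h \<alpha> (b * c - c * b - (const h * a + const h * a)) = \<zero>\<^bsub>A_alg h \<alpha>\<^esub>"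
    by (simp only: A.kernel_closed bc tr)
  define q :: "(gl2, 'k) free_alg" where "q = delta_elt - const \<alpha>"
  have q: "A_class h \<alpha> q = \<zero>\<^bsub>A_alg h \<alpha>\<^esub>"
    unfolding q_def by (rule A_class_casimir)
  \<comment> \<open>Doubling \<open>q\<close> clears the coefficient \<open>1 / 2\<close> in
    \<open>delta_elt\<close>.\<close>
  have "const (1 / 2) * p + const (1 / 2) * p = p" for p :: "(gl2, 'k) free_alg"
    by (simp add: distrib_right[symmetric] const_add[symmetric] const_one)
  from this[of "b * c + c * b"]
  have "a * a + a * a + b * c + c * b + const \<alpha> + const \<alpha> = a * (a + d) + a * (a + d) - (q + q)"
    by (simp add: q_def delta_elt_def a_def b_def c_def d_def algebra_simps)
  then show "A_class h \<alpha> (a * a + a * a + b * c + c * b + const \<alpha> + const \<alpha>) = \<zero>\<^bsub>A_alg h \<alpha>\<^esub>"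
    by (simp only: A.kernel_closed q tr)
qed


section \<open>The factorization of \<open>e\<^sub>1\<^sub>1\<close>\<close>

text \<open>The general field makes the real and complex cases two instances of one
  computation.\<close>

theorem isomorphic_projective_e11:
  fixes h \<alpha> s :: "'k::field_char_0"
  assumes s: "s\<^sup>2 = h\<^sup>2 - 4 * \<alpha>"
    and distinct: "lambda20 h s \<noteq> lambda11 h" "lambda11 h \<noteq> lambda02 h s"
  shows "isomorphic_projective (A_alg h \<alpha>) 3 (e11 h \<alpha> s) 1 (e00 h \<alpha>)"
proof -
  let ?\<phi> = "A_class h \<alpha>"
  define a b c :: "(gl2, 'k) free_alg" where "a = gen Ga" and "b = gen Gb" and "c = gen Gc"
  note rel = A_class_relations[of h \<alpha>, folded a_def b_def c_def]
  have denom: "(lambda20 h s - lambda11 h) * (lambda02 h s - lambda11 h) = 4 * \<alpha>"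
    using s by (simp add: lambda20_def lambda11_def lambda02_def algebra_simps power2_eq_square)
  with distinct have \<alpha>: "\<alpha> \<noteq> 0" by auto
  define q :: "(gl2, 'k) free_alg" where "q = const (1 / (4 * \<alpha>))"
  define L where "L = mat_of_rows_list 3
    [[const 2 * a, const 2 * b, 0], [c, 0, b], [0, const 2 * c, - (const 2 * a)]]"
  define U where "U = mat 3 1 (\<lambda>(i, _). [b, - a, - c] ! i)"
  \<comment> \<open>This is \<open>-W/(2\<alpha>)\<close> with the scalar \<open>q\<close> of
    \<open>e11\<close> factored out of the entries.\<close>
  define V where "V = mat 1 3 (\<lambda>(_, j). [- (q * (c + c)), q * (a + a + a + a), q * (b + b)] ! j)"
  define M where "M = (const (h - s) \<cdot>\<^sub>m 1\<^sub>m 3 - L) * (const (h + s) \<cdot>\<^sub>m 1\<^sub>m 3 - L)"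
  have L: "L \<in> carrier_mat 3 3"
    by (rule carrier_matI) (simp_all add: L_def mat_of_rows_list_def)
  have M: "M \<in> carrier_mat 3 3"
    unfolding M_def using L by (intro mult_carrier_mat minus_carrier_mat)
  have U: "U \<in> carrier_mat 3 1" and V: "V \<in> carrier_mat 1 3"
    by (simp_all add: U_def V_def)
  note carrier = L M U V
  have scalar_minus: "scalar_minus_L2 h \<alpha> t = map_mat ?\<phi> (const t \<cdot>\<^sub>m 1\<^sub>m 3 - L)" for t
    unfolding scalar_minus_L2_def L2_def a_def[symmetric] b_def[symmetric] c_def[symmetric]
      L_def[symmetric]
    by (simp add: A.rmat_one_eq_map_mat[of h \<alpha>] A.rmat_smult_map_mat A.rmat_minus_map_mat[OF _ L])
  have e11: "e11 h \<alpha> s = map_mat ?\<phi> (q \<cdot>\<^sub>m M)"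
    unfolding e11_def denom unfolding q_def scalar_minus M_def lambda20_def lambda02_def
    using L by (simp add: A.rmat_mult_map_mat A.rmat_smult_map_mat)
  \<comment> \<open>Opaque names make the scalars atoms for simp, governed by the centrality rules,
    \<open>SS\<close> and \<open>qC\<close>.\<close>
  define H S C :: "(gl2, 'k) free_alg"
    where H_S_C_def: "H = const h" "S = const s" "C = const \<alpha>"
  have central: "x * H = H * x" "x * S = S * x" "x * (q * y) = q * (x * y)" for x y
    unfolding H_S_C_def q_def by (rule const_commute const_left_commute)+
  \<comment> \<open>As rewrite rules, the general equations loop on products such as \<open>H * H\<close>.\<close>
  note comm = central(1)[of a] central(1)[of b] central(1)[of c] central(1)[of S]
    central(2)[of a] central(2)[of b] central(2)[of c]
    central(3)[of a] central(3)[of b] central(3)[of c]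
  have const_eqs: "const (h - s) = H - S" "const (h + s) = H + S" "const 2 * x = x + x" for x
    by (simp_all add: H_S_C_def const_add const_diff const_add[of 1 1, simplified] const_one mult_2)
  \<comment> \<open>The terms linear in \<open>S\<close> cancel in \<open>M\<close> because
    \<open>S\<close> is central; this removes the remaining \<open>S * S\<close>.\<close>
  have "const (s * s) = const (h * h - \<alpha> - \<alpha> - \<alpha> - \<alpha>)"
    using s by (intro arg_cong[of _ _ const]) (simp add: power2_eq_square)
  then have SS: "S * S = H * H - C - C - C - C"
    by (simp only: H_S_C_def const_mult const_diff)
  have "q * (C + C + C + C) = const (1 / (4 * \<alpha>) * (\<alpha> + \<alpha> + \<alpha> + \<alpha>))"
    by (simp only: H_S_C_def q_def const_mult const_add)
  also have "\<dots> = 1"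
    using \<alpha> by (simp add: const_one)
  finally have qC: "q * (C + C + C + C) = 1" .
  have VU: "map_mat ?\<phi> (V * U) = rmat_one (A_alg h \<alpha>) 1"
  proof -
    let ?r = "a * a + a * a + b * c + c * b + C + C"
    \<comment> \<open>The left side is the single entry of \<open>V * U\<close> minus 1; up to a
      multiple of the Casimir relation it is \<open>q * (C + C + C + C) - 1\<close>.\<close>
    have "- (q * (c + c)) * b + q * (a + a + a + a) * (- a) + q * (b + b) * (- c) - 1
        = q * (C + C + C + C) - 1 - q * (?r + ?r)"
      by (simp add: algebra_simps)
    also have "\<dots> = - (q * (?r + ?r))"
      by (simp add: qC)
    finally have "?\<phi> (- (q * (c + c)) * b + q * (a + a + a + a) * (- a) + q * (b + b) * (- c)) = ?\<phi> 1"
      using rel(4) by (intro A.hom_eqI) (simp only: A.kernel_closed H_S_C_def)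
    then show ?thesis
      unfolding A.rmat_one_eq_map_mat[of h \<alpha>]
      by (intro eq_matI)
        (simp_all add: U_def V_def scalar_prod_def numeral_3_eq_3 add.assoc)
  qed
  have UV: "map_mat ?\<phi> (q \<cdot>\<^sub>m M) = map_mat ?\<phi> (U * V)"
  proof -
    \<comment> \<open>The row is \<open>V\<close> with \<open>q\<close> stripped and the sign
      reversed, so \<open>q * D i j\<close> is the defect between \<open>q \<cdot>\<^sub>m M\<close>
      and \<open>U * V\<close>.\<close>
    define D where "D i j = M $$ (i, j)
      + [b, - a, - c] ! i * [c + c, - (a + a + a + a), - (b + b)] ! j" for i j
    have idx: "i \<in> {0, 1, 2}" if "i < 3" for i :: nat
      using that by auto
    have D_zero: "?\<phi> (D i j) = \<zero>\<^bsub>A_alg h \<alpha>\<^esub>" if "i \<in> {0, 1, 2}" "j \<in> {0, 1, 2}" for i j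
    proof -
      define r1 r2 r3 r4 where r: "r1 = a * b - b * a - H * b" "r2 = a * c - c * a + H * c"
        "r3 = b * c - c * b - (H * a + H * a)" "r4 = a * a + a * a + b * c + c * b + C + C"
      \<comment> \<open>Every entry is an integer combination of the four relations; in the two
        off-diagonal corners the contributions \<open>2 b b\<close> and \<open>2 c c\<close> of
        \<open>L * L\<close> cancel exactly.\<close>
      have "D 0 0 = r4 + r4 + r3 + r3" "D 0 1 = r1 + r1 + r1 + r1" "D 0 2 = 0"
        "D 1 0 = - (r2 + r2)" "D 1 1 = r4 + r4" "D 1 2 = r1 + r1"
        "D 2 0 = 0" "D 2 1 = - (r2 + r2 + r2 + r2)" "D 2 2 = r4 + r4 - r3 - r3"
        unfolding D_def M_def L_def const_eqs r
        by (simp_all add: mat_of_rows_list_def scalar_prod_def numeral_3_eq_3 numeral_2_eq_2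
            algebra_simps comm SS)
      moreover have "?\<phi> r1 = \<zero>\<^bsub>A_alg h \<alpha>\<^esub>" "?\<phi> r2 = \<zero>\<^bsub>A_alg h \<alpha>\<^esub>"
        "?\<phi> r3 = \<zero>\<^bsub>A_alg h \<alpha>\<^esub>" "?\<phi> r4 = \<zero>\<^bsub>A_alg h \<alpha>\<^esub>"
        using rel by (simp_all only: r H_S_C_def)
      ultimately show ?thesis
        using that by (auto simp only: insert_iff empty_iff A.kernel_closed A.hom_zero)
    qed
    have D: "?\<phi> (q * D i j) = \<zero>\<^bsub>A_alg h \<alpha>\<^esub>" if "i < 3" "j < 3" for i j
      using that by (intro A.kernel_closed(4) D_zero idx)
    have "(q \<cdot>\<^sub>m M) $$ (i, j) - (U * V) $$ (i, j) = q * D i j" if "i < 3" "j < 3" for i j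
    proof -
      from that have "i \<in> {0, 1, 2}" "j \<in> {0, 1, 2}"
        by (simp_all only: idx)
      then show ?thesis
        using carrier by (auto simp: U_def V_def D_def scalar_prod_def algebra_simps comm)
    qed
    with D carrier show ?thesis
      \<comment> \<open>Entries stay folded so that the difference produced by
        \<open>hom_eqI\<close> matches the identity just proved.\<close>
      by (intro eq_matI) (auto intro!: A.hom_eqI simp del: index_mult_mat(1) index_smult_mat(1))
  qed
  show ?thesis
    unfolding e11 UV e00_def
    using carrier VU by (intro A.isomorphic_projective_rmat_oneI) simp_all
qed

theorem proposition11:
  shows "(\<forall>(h::real) \<alpha> s.
            h \<noteq> 0 \<longrightarrow> s\<^sup>2 = h\<^sup>2 - 4 * \<alpha> \<longrightarrow>
            distinct [lambda20 h s, lambda11 h, lambda02 h s] \<longrightarrow>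
            isomorphic_projective (A_alg h \<alpha>) 3 (e11 h \<alpha> s) 1 (e00 h \<alpha>)) \<and>
         (\<forall>(h::complex) \<alpha> s.
            h \<noteq> 0 \<longrightarrow> s\<^sup>2 = h\<^sup>2 - 4 * \<alpha> \<longrightarrow>
            distinct [lambda20 h s, lambda11 h, lambda02 h s] \<longrightarrow>
            isomorphic_projective (A_alg h \<alpha>) 3 (e11 h \<alpha> s) 1 (e00 h \<alpha>))"
  \<comment> \<open>Removing \<open>One_nat_def\<close> keeps the dimension 1 from becoming
    \<open>Suc 0\<close>, so the rule still matches.\<close>
  by (auto intro!: isomorphic_projective_e11 simp del: One_nat_def)

end
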